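(* Every measurable relation algebra with a scaffold is completely representable.
   Context: **Relation algebras.** A relation algebra is an algebra $\mathfrak A=(A,+,-,;,{}^{\smile},1')$ such that $(A,+,-)$ is a Boolean algebra and for all $r,s,t$: $r;(s;t)=(r;s);t$, $r;1'=r$, $r^{\smile\smile}=r$, $(r;s)^\smile=s^\smile;r^\smile$, $(r+s);t=r;t+s;t$, $(r+s)^\smile=r^\smile+s^\smile$, $r^\smile;-(r;s)+-s=-s$. Order, $0$, $1$, suprema, atoms refer to the Boolean part. A function is an element $f$ with $f^\smile;f\le 1'$. A subidentity atom is an atom $x\le 1'$; it is measurable if $x;1;x$ is the sum (supremum) of a set of functions. A relation algebra is measurable if $1'$ is the sum of a set of measurable atoms. **Scaffolds.** In a measurable relation algebra let $I$ be the set of measurable atoms and $\mathcal E=\{(x,y)\in I\times I: x;1;y\neq0\}$ (an equivalence relation on $I$). A scaffold is a system $\langle a_{xy}:(x,y)\in\mathcal E\rangle$ of atoms with $a_{xy}\le x;1;y$, $a_{xx}=x$, $a_{yx}=a_{xy}^\smile$ for all $x\in I$, $(x,y)\in\mathcal E$, and $a_{xz}\le a_{xy};a_{yz}$ for all $(x,y),(y,z)\in\mathcal E$. **Complete representations.** A complete representation of a relation algebra $\mathfrak A$ is an embedding $\vartheta$ of $\mathfrak A$ into the set relation algebra of all subrelations of some equivalence relation $E$ on a set $U$ (operations: union, complement relative to $E$, relational composition, relational converse, and the identity relation $id_U$; the unit is $E$) that preserves all existing suprema as unions: whenever $a=\sum X$ exists in $\mathfrak A$, $\vartheta(a)=\bigcup\{\vartheta(b):b\in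 X\}$. $\mathfrak A$ is completely representable if it has a complete representation. *)

theory Defs
  imports Main "HOL-Library.Lub_Glb"
begin

text \<open>
  The universe of a relation algebra is a type of class \<open>boolean_algebra\<close>: \<open>sup\<close>, \<open>uminus\<close>,
  \<open>bot\<close>, \<open>top\<close> are the Boolean sum, complement, zero and unit. Degenerate algebras
  (\<open>bot = top\<close>) are included.

  Existing suprema are expressed by \<^term>\<open>isLub UNIV X a\<close>; no completeness is assumed.
\<close>

locale relation_algebra =
  fixes rcomp :: "'a::boolean_algebra \<Rightarrow> 'a \<Rightarrow> 'a"  (infixl \<open>\<^bold>;\<close> 75)
    and rconv :: "'a \<Rightarrow> 'a"
    and ident :: 'a
  assumes rcomp_assoc: "r \<^bold>; (s \<^bold>; t) = (r \<^bold>; s) \<^bold>; t"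
    and rcomp_ident: "r \<^bold>; ident = r"
    and rconv_rconv: "rconv (rconv r) = r"
    and rconv_rcomp: "rconv (r \<^bold>; s) = rconv s \<^bold>; rconv r"
    and rcomp_sup: "sup r s \<^bold>; t = sup (r \<^bold>; t) (s \<^bold>; t)"
    and rconv_sup: "rconv (sup r s) = sup (rconv r) (rconv s)"
    and tarski: "sup (rconv r \<^bold>; (- (r \<^bold>; s))) (- s) = - s"

definition ba_atom :: "'a::boolean_algebra \<Rightarrow> bool" where
  "ba_atom x \<longleftrightarrow> x \<noteq> bot \<and> (\<forall>y. y \<le> x \<longrightarrow> y = bot \<or> y = x)"

text \<open>
  A complete representation, with base set \<open>U\<close> and unit \<open>E\<close>, into the algebra of all
  subrelations of \<open>E\<close>. For \<open>X = {}\<close> the last clause gives \<open>\<theta> bot = {}\<close>.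
\<close>

definition complete_representation ::
  "('a::boolean_algebra \<Rightarrow> 'a \<Rightarrow> 'a) \<Rightarrow> ('a \<Rightarrow> 'a) \<Rightarrow> 'a \<Rightarrow>
   'u set \<Rightarrow> ('u \<times> 'u) set \<Rightarrow> ('a \<Rightarrow> ('u \<times> 'u) set) \<Rightarrow> bool" where
  "complete_representation rcomp rconv ident U E \<theta> \<longleftrightarrow>
     equiv U E \<and>
     (\<forall>a. \<theta> a \<subseteq> E) \<and>
     inj \<theta> \<and>
     (\<forall>a b. \<theta> (sup a b) = \<theta> a \<union> \<theta> b) \<and>
     (\<forall>a. \<theta> (- a) = E - \<theta> a) \<and>
     (\<forall>a b. \<theta> (rcomp a b) = \<theta> a O \<theta> b) \<and>
     (\<forall>a. \<theta> (rconv a) = (\<theta> a)\<inverse>) \<and>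
     \<theta> ident = Id_on U \<and>
     (\<forall>X a. isLub UNIV X a \<longrightarrow> \<theta> a = (\<Union>b\<in>X. \<theta> b))"

text \<open>
  HOL cannot quantify existentially over the type of the base set, so base sets are taken inside
  \<^typ>\<open>'a + nat\<close>. This loses no generality. Any complete representation restricts to one whose
  base has cardinality at most that of \<^typ>\<open>'a + nat\<close>: choose a pair in \<open>\<theta> b\<close> for each
  \<open>b \<noteq> bot\<close>, close the set of chosen points under witnesses for \<open>\<theta> (rcomp b c) = \<theta> b O \<theta> c\<close>,
  and intersect every relation with the square of the resulting set. The summand \<^typ>\<open>nat\<close>
  is needed because a finite algebra may only have infinite representations.
\<close>

definition completely_representable ::
  "('a::boolean_algebra \<Rightarrow> 'a \<Rightarrow> 'a) \<Rightarrow> ('a \<Rightarrow> 'a) \<Rightarrow> 'a \<Rightarrow> bool" where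
  "completely_representable rcomp rconv ident \<longleftrightarrow>
     (\<exists>(U :: ('a + nat) set) E \<theta>. complete_representation rcomp rconv ident U E \<theta>)"

context relation_algebra
begin

definition is_function :: "'a \<Rightarrow> bool" where
  "is_function f \<longleftrightarrow> rconv f \<^bold>; f \<le> ident"

definition measurable_atom :: "'a \<Rightarrow> bool" where
  "measurable_atom x \<longleftrightarrow>
     ba_atom x \<and> x \<le> ident \<and> (\<exists>F. (\<forall>f\<in>F. is_function f) \<and> isLub UNIV F (x \<^bold>; top \<^bold>; x))"

definition atom_rel :: "('a \<times> 'a) set" where
  "atom_rel = {(x, y). measurable_atom x \<and> measurable_atom y \<and> x \<^bold>; top \<^bold>; y \<noteq> bot}"

text \<open>
  Only the values \<open>a x y\<close> with \<open>(x, y) \<in> atom_rel\<close> matter; this set contains \<open>(x, x)\<close> for every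
  measurable atom \<open>x\<close>.
\<close>

definition scaffold :: "('a \<Rightarrow> 'a \<Rightarrow> 'a) \<Rightarrow> bool" where
  "scaffold a \<longleftrightarrow>
     (\<forall>(x, y)\<in>atom_rel. ba_atom (a x y) \<and> a x y \<le> x \<^bold>; top \<^bold>; y) \<and>
     (\<forall>x. measurable_atom x \<longrightarrow> a x x = x) \<and>
     (\<forall>(x, y)\<in>atom_rel. a y x = rconv (a x y)) \<and>
     (\<forall>x y z. (x, y) \<in> atom_rel \<longrightarrow> (y, z) \<in> atom_rel \<longrightarrow> a x z \<le> a x y \<^bold>; a y z)"

end

locale measurable_relation_algebra = relation_algebra +
  assumes measurable: "\<exists>X. (\<forall>x\<in>X. measurable_atom x) \<and> isLub UNIV X ident"

end

theory Submission
  imports Defs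
begin

text \<open>
  For a measurable atom \<open>x\<close>, the nonzero functions below \<open>x;1;x\<close> are atoms and form a group
  \<open>G\<^sub>x\<close> with unit \<open>x\<close>. The disjoint union of these groups is the base set, and the pair
  of \<open>g \<in> G\<^sub>x\<close> and \<open>h \<in> G\<^sub>y\<close> is labelled by the atom \<open>g\<^sup>\<smile>;a\<^sub>x\<^sub>y;h\<close>. The scaffold
  conditions say precisely that this labelling is coherent. A composition \<open>b;c\<close> above a label
  yields labels \<open>g\<^sup>\<smile>;a\<^sub>x\<^sub>z;k \<le> b\<close> and \<open>m\<^sup>\<smile>;a\<^sub>z\<^sub>y;h \<le> c\<close> with
  \<open>k;m\<^sup>\<smile> \<le> a\<^sub>z\<^sub>x;a\<^sub>x\<^sub>y;a\<^sub>y\<^sub>z \<le> (a\<^sub>z\<^sub>x;a\<^sub>x\<^sub>z);(a\<^sub>z\<^sub>y;a\<^sub>y\<^sub>z)\<close>. The two factors on the right are the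
  sums of the stabilizers of \<open>a\<^sub>x\<^sub>z\<close> and \<open>a\<^sub>z\<^sub>y\<close> in \<open>G\<^sub>z\<close>, so \<open>k\<close> and \<open>m\<close> can be
  adjusted to a common witness without changing the labels.
\<close>

section \<open>Atoms and existing suprema in a Boolean algebra\<close>

lemma isLub_meets:
  fixes c :: "'a::boolean_algebra"
  assumes "isLub UNIV X s" and "inf c s \<noteq> bot"
  shows "\<exists>b\<in>X. inf c b \<noteq> bot"
proof (rule ccontr)
  assume "\<not> ?thesis"
  \<comment> \<open>If \<open>c\<close> misses every member of \<open>X\<close>, then
    \<open>- c\<close> is an upper bound of \<open>X\<close>, hence above \<open>s\<close>.\<close>
  then have "b \<le> - c" if "b \<in> X" for b
    using that by (metis inf.commute inf_shunt)
  then have "s \<le> - c"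
    using assms(1) by (simp add: isLub_def leastP_def isUb_def setle_def setge_def)
  then show False
    using assms(2) by (metis inf.commute inf_shunt)
qed

lemma ba_atom_le_if_meets: "ba_atom p \<Longrightarrow> inf p b \<noteq> bot \<Longrightarrow> p \<le> b"
  unfolding ba_atom_def by (metis inf_le1 inf_le2)

lemma ba_atom_le_compl_iff: "ba_atom p \<Longrightarrow> p \<le> - b \<longleftrightarrow> \<not> p \<le> b"
  unfolding ba_atom_def
  by (metis double_compl inf.absorb_iff1 inf_le1 inf_le2 inf_shunt)

text \<open>Atoms are completely prime, even without completeness of the algebra. Since labels are
  atoms, this gives preservation of all existing suprema.\<close>

lemma ba_atom_le_isLub_iff:
  fixes p :: "'a::boolean_algebra"
  assumes "ba_atom p" "isLub UNIV X s"
  shows "p \<le> s \<longleftrightarrow> (\<exists>b\<in>X. p \<le> b)"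
proof
  assume "p \<le> s"
  then have "inf p s \<noteq> bot"
    using assms(1) by (simp add: ba_atom_def inf.absorb1)
  then show "\<exists>b\<in>X. p \<le> b"
    using isLub_meets[OF assms(2)] ba_atom_le_if_meets[OF assms(1)] by blast
next
  assume "\<exists>b\<in>X. p \<le> b"
  then show "p \<le> s"
    using isLubD2[OF assms(2)] order_trans by blast
qed

text \<open>Makes the clause for binary joins an instance of the clause for suprema.\<close>

lemma isLub_sup: "isLub UNIV {a, b} (sup a b :: 'a::boolean_algebra)"
  by (auto simp: isLub_def leastP_def isUb_def setle_def setge_def)

section \<open>Arithmetic of relation algebras: cycle laws and modular law\<close>

context relation_algebra
begin

lemma rconv_mono: "r \<le> s \<Longrightarrow> rconv r \<le> rconv s"
  by (metis rconv_sup sup.absorb_iff2)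

lemma rconv_le_iff: "rconv r \<le> s \<longleftrightarrow> r \<le> rconv s"
  by (metis rconv_mono rconv_rconv)

lemma rconv_bot [simp]: "rconv bot = bot"
  by (metis bot.extremum rconv_le_iff bot.extremum_uniqueI)

lemma rconv_top [simp]: "rconv top = top"
  by (metis rconv_le_iff top.extremum top.extremum_uniqueI)

lemma rconv_eq_bot_iff [simp]: "rconv r = bot \<longleftrightarrow> r = bot"
  by (metis rconv_bot rconv_rconv)

lemma rconv_inf: "rconv (inf r s) = inf (rconv r) (rconv s)"
proof (rule antisym)
  show "rconv (inf r s) \<le> inf (rconv r) (rconv s)"
    by (simp add: rconv_mono)
  show "inf (rconv r) (rconv s) \<le> rconv (inf r s)"
    by (metis inf.cobounded1 inf.cobounded2 le_inf_iff rconv_le_iff)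
qed

lemma rconv_ident [simp]: "rconv ident = ident"
  by (metis rcomp_ident rconv_rcomp rconv_rconv)

lemma ident_rcomp: "ident \<^bold>; r = r"
  by (metis rcomp_ident rconv_ident rconv_rcomp rconv_rconv)

lemma rcomp_sup_right: "r \<^bold>; sup s t = sup (r \<^bold>; s) (r \<^bold>; t)"
  by (metis rcomp_sup rconv_rcomp rconv_rconv rconv_sup)

lemma rcomp_mono: "r \<le> r' \<Longrightarrow> s \<le> s' \<Longrightarrow> r \<^bold>; s \<le> r' \<^bold>; s'"
  by (metis le_supE order_refl order_trans rcomp_sup rcomp_sup_right sup.absorb2)

text \<open>The cycle law. Disjointness means lying below a complement, so one direction is
  monotonicity followed by the axiom \<open>tarski\<close>; the other is the same argument for
  \<open>rconv r\<close>.\<close>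

lemma peirce: "inf t (r \<^bold>; s) = bot \<longleftrightarrow> inf (rconv r \<^bold>; t) s = bot"
proof
  assume "inf t (r \<^bold>; s) = bot"
  then have "t \<le> - (r \<^bold>; s)" by (metis inf_shunt)
  then have "rconv r \<^bold>; t \<le> rconv r \<^bold>; - (r \<^bold>; s)" by (simp add: rcomp_mono)
  also have "\<dots> \<le> - s" using tarski sup.absorb_iff2 by blast
  finally show "inf (rconv r \<^bold>; t) s = bot" by (simp add: inf_shunt)
next
  assume "inf (rconv r \<^bold>; t) s = bot"
  then have "s \<le> - (rconv r \<^bold>; t)" by (simp add: inf_shunt inf.commute)
  then have "r \<^bold>; s \<le> r \<^bold>; - (rconv r \<^bold>; t)" by (simp add: rcomp_mono)
  also have "\<dots> \<le> - t" using tarski[of "rconv r"] sup.absorb_iff2 by (metis rconv_rconv)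
  finally show "inf t (r \<^bold>; s) = bot" by (metis inf.commute inf_shunt)
qed

lemma peirce': "inf t (r \<^bold>; s) = bot \<longleftrightarrow> inf (t \<^bold>; rconv s) r = bot"
proof -
  have "inf t (r \<^bold>; s) = bot \<longleftrightarrow> inf (rconv t) (rconv s \<^bold>; rconv r) = bot"
    by (metis rconv_eq_bot_iff rconv_inf rconv_rcomp)
  also have "\<dots> \<longleftrightarrow> inf (s \<^bold>; rconv t) (rconv r) = bot"
    by (simp add: peirce rconv_rconv)
  also have "\<dots> \<longleftrightarrow> inf (t \<^bold>; rconv s) r = bot"
    by (metis rconv_eq_bot_iff rconv_inf rconv_rcomp rconv_rconv)
  finally show ?thesis .
qed

lemma rcomp_bot [simp]: "r \<^bold>; bot = bot"
  by (metis inf_bot_right inf_top_left peirce)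

text \<open>Split \<open>s\<close> along \<open>rconv r ; t\<close>. By the cycle law,
  \<open>r\<close> composed with the outer part is disjoint from \<open>t\<close>.\<close>

lemma modular: "inf (r \<^bold>; s) t \<le> r \<^bold>; inf s (rconv r \<^bold>; t)"
proof -
  let ?u = "inf s (rconv r \<^bold>; t)" and ?v = "inf s (- (rconv r \<^bold>; t))"
  have "s = sup ?u ?v"
    by (simp flip: inf_sup_distrib1)
  then have "r \<^bold>; s = sup (r \<^bold>; ?u) (r \<^bold>; ?v)"
    by (metis rcomp_sup_right)
  moreover have "inf t (r \<^bold>; ?v) = bot"
    by (simp add: peirce inf.left_commute)
  ultimately have "inf (r \<^bold>; s) t = inf (r \<^bold>; ?u) t"
    by (metis inf.commute inf_sup_distrib1 sup_bot_right)
  then show ?thesis by (metis inf_le1)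
qed

lemma le_rcomp_rconv_rcomp: "r \<le> r \<^bold>; (rconv r \<^bold>; r)"
  using modular[of r ident r] rcomp_mono[OF order_refl inf_le2, of r ident "rconv r \<^bold>; r"]
  by (simp add: rcomp_ident)

section \<open>Elements below the identity\<close>

lemma subident_rcomp_le: "x \<le> ident \<Longrightarrow> x \<^bold>; r \<le> r"
  using rcomp_mono[of x ident r r] by (simp add: ident_rcomp)

lemma rcomp_subident_le: "x \<le> ident \<Longrightarrow> r \<^bold>; x \<le> r"
  using rcomp_mono[of r r x ident] by (simp add: rcomp_ident)

lemma rconv_subident:
  assumes "x \<le> ident" shows "rconv x = x"
proof -
  have 1: "y \<le> rconv y" if "y \<le> ident" for y
  proof -
    have "rconv y \<le> ident" using that by (simp add: rconv_le_iff)
    \<comment> \<open>The left side is above \<open>y\<close>, the right side is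
      \<open>rconv y\<close>.\<close>
    then have "y \<^bold>; rconv y \<^bold>; y \<le> ident \<^bold>; rconv y \<^bold>; ident"
      using that by (intro rcomp_mono) auto
    then show ?thesis
      using le_rcomp_rconv_rcomp[of y] by (simp add: rcomp_assoc rcomp_ident ident_rcomp)
  qed
  have "rconv x \<le> ident" using assms by (simp add: rconv_le_iff)
  then show ?thesis using 1[of x] 1[of "rconv x"] assms by (simp add: rconv_rconv)
qed

lemma subident_idem:
  assumes "x \<le> ident" shows "x \<^bold>; x = x"
proof (rule antisym)
  show "x \<^bold>; x \<le> x" using assms by (rule subident_rcomp_le)
  have "x \<le> x \<^bold>; (x \<^bold>; x)" using le_rcomp_rconv_rcomp[of x] assms by (simp add: rconv_subident)
  also have "\<dots> \<le> x \<^bold>; x" using assms by (simp add: rcomp_mono subident_rcomp_le)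
  finally show "x \<le> x \<^bold>; x" .
qed

text \<open>Turns bounds such as \<open>r \<le> x ; top ; y\<close> into unit laws; the nontrivial
  inequality is the modular law.\<close>

lemma subident_rcomp_absorb: "x \<le> ident \<Longrightarrow> r \<le> x \<^bold>; s \<Longrightarrow> x \<^bold>; r = r"
proof (rule antisym)
  assume x: "x \<le> ident" and r: "r \<le> x \<^bold>; s"
  show "x \<^bold>; r \<le> r" using x by (rule subident_rcomp_le)
  have "r = inf (x \<^bold>; s) r" using r by (simp add: inf.absorb2)
  also have "\<dots> \<le> x \<^bold>; inf s (rconv x \<^bold>; r)" by (rule modular)
  also have "\<dots> \<le> x \<^bold>; r"
    using x by (simp add: rcomp_mono le_infI2 rconv_subident subident_rcomp_le)
  finally show "r \<le> x \<^bold>; r" .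
qed

lemma rcomp_subident_absorb: "x \<le> ident \<Longrightarrow> r \<le> s \<^bold>; x \<Longrightarrow> r \<^bold>; x = r"
  by (metis rconv_mono rconv_rcomp rconv_rconv rconv_subident subident_rcomp_absorb)

lemma subident_le_of_le_rcomp:
  assumes "x \<le> ident" "e \<le> ident" "e \<le> x \<^bold>; s" shows "e \<le> x"
  by (metis assms rcomp_subident_le subident_rcomp_absorb)

lemma subident_le_of_le_rcomp':
  assumes "x \<le> ident" "e \<le> ident" "e \<le> s \<^bold>; x" shows "e \<le> x"
  by (metis assms subident_rcomp_le rcomp_subident_absorb)

section \<open>The group at a subidentity element and its action on atoms\<close>

definition grp :: "'a \<Rightarrow> 'a set" where
  "grp x = {f. f \<^bold>; rconv f = x \<and> rconv f \<^bold>; f = x}"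

lemma grp_rconv: "f \<in> grp x \<Longrightarrow> rconv f \<in> grp x"
  by (simp add: grp_def rconv_rconv)

lemma grp_rcomp_rconv: "f \<in> grp x \<Longrightarrow> f \<^bold>; rconv f = x"
  by (simp add: grp_def)

lemma grp_rconv_rcomp: "f \<in> grp x \<Longrightarrow> rconv f \<^bold>; f = x"
  by (simp add: grp_def)

lemma grp_unit: "x \<le> ident \<Longrightarrow> x \<in> grp x"
  by (simp add: grp_def rconv_subident subident_idem)

lemma grp_left_unit: "x \<le> ident \<Longrightarrow> f \<in> grp x \<Longrightarrow> x \<^bold>; f = f"
  using le_rcomp_rconv_rcomp[of f] subident_rcomp_le[of x f]
  by (simp add: rcomp_assoc grp_rcomp_rconv)

lemma grp_right_unit: "x \<le> ident \<Longrightarrow> f \<in> grp x \<Longrightarrow> f \<^bold>; x = f"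
  using le_rcomp_rconv_rcomp[of f] rcomp_subident_le[of x f]
  by (simp add: grp_rconv_rcomp)

lemma grp_rcomp:
  assumes "x \<le> ident" "f \<in> grp x" "g \<in> grp x" shows "f \<^bold>; g \<in> grp x"
proof -
  have "f \<^bold>; g \<^bold>; rconv (f \<^bold>; g) = f \<^bold>; (g \<^bold>; rconv g) \<^bold>; rconv f"
    by (simp add: rconv_rcomp rcomp_assoc)
  also have "\<dots> = x"
    by (simp only: grp_rcomp_rconv[OF assms(3)] grp_right_unit[OF assms(1,2)]
        grp_rcomp_rconv[OF assms(2)])
  finally have "f \<^bold>; g \<^bold>; rconv (f \<^bold>; g) = x" .
  moreover have "rconv (f \<^bold>; g) \<^bold>; (f \<^bold>; g) = rconv g \<^bold>; (rconv f \<^bold>; f) \<^bold>; g"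
    by (simp add: rconv_rcomp rcomp_assoc)
  then have "rconv (f \<^bold>; g) \<^bold>; (f \<^bold>; g) = x"
    by (simp only: grp_rconv_rcomp[OF assms(2)] grp_rconv_rcomp[OF assms(3)]
        grp_right_unit[OF assms(1) grp_rconv[OF assms(3)]])
  ultimately show ?thesis by (simp add: grp_def)
qed

text \<open>For a measurable atom \<open>x\<close>, this and \<open>function_in_grp\<close> identify
  the solutions of the equations in \<open>grp\<close> with the nonzero functions below
  \<open>x ; top ; x\<close>.\<close>

lemma grp_le: "x \<le> ident \<Longrightarrow> f \<in> grp x \<Longrightarrow> f \<le> x \<^bold>; top \<^bold>; x"
  using rcomp_mono[OF rcomp_mono[OF order_refl top_greatest] order_refl, of x f x]
  by (simp add: grp_left_unit grp_right_unit)

lemma grp_cancel_left: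
  "x \<le> ident \<Longrightarrow> g \<in> grp x \<Longrightarrow> c \<le> x \<^bold>; s \<Longrightarrow> rconv g \<^bold>; (g \<^bold>; c) = c"
  by (simp add: rcomp_assoc grp_rconv_rcomp subident_rcomp_absorb)

text \<open>Left multiplication by \<open>g\<close> is a monotone bijection on the elements that
  \<open>x\<close> fixes from the left, with inverse multiplication by \<open>rconv g\<close>; so it
  preserves atoms.\<close>

lemma grp_rcomp_atom:
  assumes x: "x \<le> ident" and g: "g \<in> grp x" and p: "ba_atom p" "p \<le> x \<^bold>; s"
  shows "ba_atom (g \<^bold>; p)"
  unfolding ba_atom_def
proof (intro conjI allI impI)
  show "g \<^bold>; p \<noteq> bot"
    using grp_cancel_left[OF x g p(2)] p(1) by (auto simp: ba_atom_def)
next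
  fix q assume q: "q \<le> g \<^bold>; p"
  have "q \<le> x \<^bold>; (g \<^bold>; p)"
    using q x g by (simp add: rcomp_assoc grp_left_unit)
  then have gg: "g \<^bold>; (rconv g \<^bold>; q) = q"
    using grp_cancel_left[OF x grp_rconv[OF g]] by (simp add: rconv_rconv)
  have "rconv g \<^bold>; q \<le> p"
    using grp_cancel_left[OF x g p(2)] rcomp_mono[OF order_refl q] by metis
  then have "rconv g \<^bold>; q = bot \<or> rconv g \<^bold>; q = p"
    using p(1) by (simp add: ba_atom_def)
  then show "q = bot \<or> q = g \<^bold>; p"
    using gg by auto
qed

lemma ba_atom_rconv: "ba_atom p \<Longrightarrow> ba_atom (rconv p)"
  unfolding ba_atom_def by (metis rconv_bot rconv_le_iff rconv_rconv)

lemma rcomp_grp_atom: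
  assumes "x \<le> ident" "g \<in> grp x" "ba_atom p" "p \<le> s \<^bold>; x"
  shows "ba_atom (p \<^bold>; g)"
proof -
  have "rconv p \<le> x \<^bold>; rconv s"
    using rconv_mono[OF assms(4)] assms(1) by (simp add: rconv_rcomp rconv_subident)
  then have "ba_atom (rconv g \<^bold>; rconv p)"
    using grp_rcomp_atom assms ba_atom_rconv grp_rconv by metis
  then show ?thesis
    using ba_atom_rconv by (metis rconv_rcomp rconv_rconv)
qed

lemma grp_atom: "x \<le> ident \<Longrightarrow> ba_atom x \<Longrightarrow> g \<in> grp x \<Longrightarrow> ba_atom g"
  by (metis grp_rcomp_atom grp_right_unit order_refl subident_idem)

section \<open>Functions below \<open>x ; top ; x\<close>\<close>

lemma function_rconv_rcomp:
  assumes x: "x \<le> ident" "ba_atom x"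
    and f: "f \<noteq> bot" "f \<le> x \<^bold>; top \<^bold>; x" "is_function f"
  shows "rconv f \<^bold>; f = x"
proof -
  have "rconv f \<^bold>; f \<le> ident" using f(3) by (simp add: is_function_def)
  moreover have "f \<^bold>; x = f" by (rule rcomp_subident_absorb[OF x(1) f(2)])
  then have "rconv f \<^bold>; f = rconv f \<^bold>; f \<^bold>; x" by (metis rcomp_assoc)
  ultimately have "rconv f \<^bold>; f \<le> x"
    using subident_le_of_le_rcomp'[OF x(1)] by (metis order_refl)
  moreover have "rconv f \<^bold>; f \<noteq> bot"
    using f(1) le_rcomp_rconv_rcomp[of f] by (metis bot.extremum_uniqueI rcomp_bot)
  ultimately show ?thesis using x(2) unfolding ba_atom_def by blast
qed

text \<open>A nonzero part \<open>g\<close> of \<open>f\<close> has full domain \<open>x\<close>, and a function is determined by its domain.\<close>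

lemma function_atom:
  assumes x: "x \<le> ident" "ba_atom x"
    and f: "f \<noteq> bot" "f \<le> x \<^bold>; top \<^bold>; x" "is_function f"
  shows "ba_atom f"
  unfolding ba_atom_def
proof (intro conjI allI impI)
  show "f \<noteq> bot" by (rule f(1))
next
  fix g assume g: "g \<le> f"
  show "g = bot \<or> g = f"
  proof (cases "g = bot")
    case False
    \<comment> \<open>The part of the domain of \<open>g\<close> inside the atom \<open>x\<close>.
      The cycle law shows it nonzero because \<open>g\<close> meets \<open>x ; g\<close>.\<close>
    let ?d = "inf x (g \<^bold>; rconv g)"
    have xg: "x \<^bold>; g = g"
      using subident_rcomp_absorb[OF x(1), of g "top \<^bold>; x"] order_trans[OF g f(2)]
      by (simp add: rcomp_assoc)
    have "?d \<noteq> bot"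
    proof -
      have "inf g (x \<^bold>; g) \<noteq> bot" using xg False by simp
      then show ?thesis using peirce'[of g x g] by (simp only: inf.commute simp_thms)
    qed
    then have "x \<le> g \<^bold>; rconv g" using ba_atom_le_if_meets x(2) by blast
    moreover have "x \<^bold>; f = f"
      using subident_rcomp_absorb[OF x(1), of f "top \<^bold>; x"] f(2) by (simp add: rcomp_assoc)
    ultimately have "f \<le> g \<^bold>; rconv g \<^bold>; f"
      using rcomp_mono[OF _ order_refl, of x "g \<^bold>; rconv g" f] by simp
    also have "\<dots> \<le> g \<^bold>; (rconv f \<^bold>; f)"
      using g by (simp add: rcomp_assoc rcomp_mono rconv_mono)
    also have "\<dots> \<le> g"
      using f(3) by (simp add: rcomp_subident_le is_function_def)
    finally show ?thesis using g by auto
  qed simp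
qed

lemma measurable_atom_le_ident: "measurable_atom x \<Longrightarrow> x \<le> ident"
  by (simp add: measurable_atom_def)

lemma measurable_atom_atom: "measurable_atom x \<Longrightarrow> ba_atom x"
  by (simp add: measurable_atom_def)

text \<open>A nonzero \<open>c\<close> meets one of the functions that sum to
  \<open>x ; top ; x\<close>, and anything below a function is a function.\<close>

lemma measurable_obtain_function:
  assumes x: "measurable_atom x" and c: "c \<noteq> bot" "c \<le> x \<^bold>; top \<^bold>; x"
  obtains f where "f \<noteq> bot" "f \<le> x \<^bold>; top \<^bold>; x" "is_function f" "f \<le> c"
proof -
  obtain F where F: "\<forall>f\<in>F. is_function f" "isLub UNIV F (x \<^bold>; top \<^bold>; x)"
    using x by (auto simp: measurable_atom_def)
  have "inf c (x \<^bold>; top \<^bold>; x) \<noteq> bot"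
    using c by (simp add: inf.absorb1)
  then obtain f where f: "f \<in> F" "inf c f \<noteq> bot"
    using isLub_meets[OF F(2)] by blast
  have "rconv (inf c f) \<^bold>; inf c f \<le> rconv f \<^bold>; f"
    by (simp add: rcomp_mono rconv_mono)
  then have "is_function (inf c f)"
    using F(1)[rule_format, OF f(1)] unfolding is_function_def by (rule order_trans)
  then show thesis
    using that[of "inf c f"] f(2) c(2) by (simp add: le_infI1)
qed

text \<open>The converse of a function below \<open>x;1;x\<close> is an atom, hence lies below a function.\<close>

lemma function_in_grp:
  assumes x: "measurable_atom x"
    and f: "f \<noteq> bot" "f \<le> x \<^bold>; top \<^bold>; x" "is_function f"
  shows "f \<in> grp x"
proof -
  note x' = measurable_atom_le_ident[OF x] measurable_atom_atom[OF x]
  have at: "ba_atom (rconv f)"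
    using function_atom[OF x' f] by (rule ba_atom_rconv)
  have le: "rconv f \<le> x \<^bold>; top \<^bold>; x"
    using rconv_mono[OF f(2)] x'(1) by (simp add: rconv_rcomp rconv_subident rcomp_assoc)
  have "rconv f \<noteq> bot" using f(1) by simp
  then obtain g where "g \<noteq> bot" "is_function g" "g \<le> rconv f"
    using measurable_obtain_function[OF x _ le] by blast
  then have "is_function (rconv f)"
    using at by (auto simp: ba_atom_def)
  then have "rconv (rconv f) \<^bold>; rconv f = x"
    by (rule function_rconv_rcomp[OF x' \<open>rconv f \<noteq> bot\<close> le])
  moreover have "rconv f \<^bold>; f = x"
    using function_rconv_rcomp[OF x' f] .
  ultimately show ?thesis
    by (simp add: grp_def rconv_rconv)
qed

lemma measurable_obtain_grp:
  assumes "measurable_atom x" "c \<noteq> bot" "c \<le> x \<^bold>; top \<^bold>; x"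
  obtains f where "f \<in> grp x" "f \<le> c"
proof -
  obtain f where "f \<noteq> bot" "f \<le> x \<^bold>; top \<^bold>; x" "is_function f" "f \<le> c"
    by (rule measurable_obtain_function[OF assms])
  then show thesis using that function_in_grp[OF assms(1)] by blast
qed

lemma measurable_meets_grp:
  assumes "measurable_atom x" "inf c (x \<^bold>; top \<^bold>; x) \<noteq> bot"
  obtains f where "f \<in> grp x" "f \<le> c"
proof -
  obtain f where f: "f \<in> grp x" "f \<le> inf c (x \<^bold>; top \<^bold>; x)"
    by (rule measurable_obtain_grp[OF assms inf_le2])
  show thesis using f(1) order_trans[OF f(2) inf_le1] by (rule that)
qed

end

section \<open>Scaffold atoms and their stabilizers\<close>

locale scaffolded_relation_algebra = measurable_relation_algebra +
  fixes a :: "'a \<Rightarrow> 'a \<Rightarrow> 'a"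
  assumes scaffold: "scaffold a"
begin

lemma atom_relD:
  assumes "(x, y) \<in> atom_rel"
  shows "measurable_atom x" "measurable_atom y" "x \<le> ident" "y \<le> ident"
  using assms by (auto simp: atom_rel_def measurable_atom_le_ident)

lemma a_atom: "(x, y) \<in> atom_rel \<Longrightarrow> ba_atom (a x y)"
  and a_le: "(x, y) \<in> atom_rel \<Longrightarrow> a x y \<le> x \<^bold>; top \<^bold>; y"
  and a_refl: "measurable_atom x \<Longrightarrow> a x x = x"
  and a_rconv: "(x, y) \<in> atom_rel \<Longrightarrow> rconv (a x y) = a y x"
  and a_trans: "(x, y) \<in> atom_rel \<Longrightarrow> (y, z) \<in> atom_rel \<Longrightarrow> a x z \<le> a x y \<^bold>; a y z"
  using scaffold by (auto simp: scaffold_def)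

lemma atom_rel_refl:
  assumes "measurable_atom x" shows "(x, x) \<in> atom_rel"
proof -
  have "x \<le> x \<^bold>; top \<^bold>; x"
    using grp_le grp_unit measurable_atom_le_ident[OF assms] by blast
  then show ?thesis
    using assms by (auto simp: atom_rel_def measurable_atom_def ba_atom_def bot_unique)
qed

lemma atom_rel_sym:
  assumes "(x, y) \<in> atom_rel" shows "(y, x) \<in> atom_rel"
proof -
  have "rconv (x \<^bold>; top \<^bold>; y) = y \<^bold>; top \<^bold>; x"
    using atom_relD[OF assms] by (simp add: rconv_rcomp rconv_subident rcomp_assoc)
  then show ?thesis
    using assms by (auto simp: atom_rel_def)
qed

lemma a_left: "(x, y) \<in> atom_rel \<Longrightarrow> x \<^bold>; a x y = a x y"
  by (metis a_le atom_relD(3) rcomp_assoc subident_rcomp_absorb)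

lemma a_right: "(x, y) \<in> atom_rel \<Longrightarrow> a x y \<^bold>; y = a x y"
  by (metis a_le atom_relD(4) rcomp_subident_absorb)

text \<open>The triangle condition for \<open>x\<close>, \<open>y\<close>, \<open>x\<close>,
  together with \<open>a x x = x\<close>.\<close>

lemma unit_le_a_rcomp: "(x, y) \<in> atom_rel \<Longrightarrow> x \<le> a x y \<^bold>; a y x"
  by (metis a_refl a_trans atom_relD(1) atom_rel_sym)

lemma atom_rel_trans:
  assumes xy: "(x, y) \<in> atom_rel" and yz: "(y, z) \<in> atom_rel"
  shows "(x, z) \<in> atom_rel"
proof -
  \<comment> \<open>The product \<open>a x y ; a y z\<close> will witness that
    \<open>x ; top ; z\<close> is nonzero: multiplying it by \<open>a y x\<close> gives an element
    above the atom \<open>a y z\<close>.\<close>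
  have "a y z \<le> a y x \<^bold>; a x y \<^bold>; a y z"
    using unit_le_a_rcomp[OF atom_rel_sym[OF xy]] a_left[OF yz] rcomp_mono[OF _ order_refl]
    by metis
  then have "a x y \<^bold>; a y z \<noteq> bot"
    using a_atom[OF yz] by (metis ba_atom_def bot_unique rcomp_assoc rcomp_bot)
  moreover have "a x y \<^bold>; a y z = x \<^bold>; (a x y \<^bold>; a y z) \<^bold>; z"
    by (metis a_left[OF xy] a_right[OF yz] rcomp_assoc)
  then have "a x y \<^bold>; a y z \<le> x \<^bold>; top \<^bold>; z"
    by (metis order_refl rcomp_mono top_greatest)
  ultimately show ?thesis
    using xy yz by (auto simp: atom_rel_def bot_unique)
qed

text \<open>Since \<open>x \<le> a x z ; a z x\<close>, all of \<open>x ; top ; z\<close> lies below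
  \<open>a x z ; (z ; top ; z)\<close>. The cycle law moves \<open>a x z\<close> across to
  \<open>c\<close>, and measurability of \<open>z\<close> then supplies \<open>k\<close>.\<close>

lemma obtain_a_rcomp_grp:
  assumes xz: "(x, z) \<in> atom_rel" and c: "c \<noteq> bot" "c \<le> x \<^bold>; top \<^bold>; z"
  obtains k where "k \<in> grp z" "a x z \<^bold>; k \<le> c"
proof -
  note id = atom_relD(3,4)[OF xz]
  have "x \<^bold>; top \<^bold>; z \<le> (a x z \<^bold>; a z x) \<^bold>; top \<^bold>; z"
    by (intro rcomp_mono order_refl unit_le_a_rcomp[OF xz])
  also have "\<dots> = a x z \<^bold>; (z \<^bold>; (a z x \<^bold>; top) \<^bold>; z)"
    by (metis a_left[OF atom_rel_sym[OF xz]] rcomp_assoc)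
  also have "\<dots> \<le> a x z \<^bold>; (z \<^bold>; top \<^bold>; z)"
    by (intro rcomp_mono order_refl top_greatest)
  finally have "inf c (a x z \<^bold>; (z \<^bold>; top \<^bold>; z)) \<noteq> bot"
    using c by (metis inf.absorb1 order_trans)
  then have "inf (rconv (a x z) \<^bold>; c) (z \<^bold>; top \<^bold>; z) \<noteq> bot"
    using peirce by blast
  then obtain k where k: "k \<in> grp z" "k \<le> rconv (a x z) \<^bold>; c"
    using measurable_meets_grp[OF atom_relD(2)[OF xz]] by blast
  have "k \<noteq> bot"
    using grp_atom[OF id(2) measurable_atom_atom[OF atom_relD(2)[OF xz]] k(1)]
    by (simp add: ba_atom_def)
  then have "inf c (a x z \<^bold>; k) \<noteq> bot"
    using k(2) peirce[of c "a x z" k] by (simp add: inf.absorb2)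
  moreover have "ba_atom (a x z \<^bold>; k)"
    using rcomp_grp_atom[OF id(2) k(1) a_atom[OF xz] a_le[OF xz]] .
  ultimately have "a x z \<^bold>; k \<le> c"
    by (simp add: ba_atom_le_if_meets inf.commute)
  then show thesis using that k(1) by blast
qed

text \<open>As \<open>a z x\<close> is the converse of \<open>a x z\<close>, the cycle law turns the
  bound on \<open>f\<close> into the statement that the atoms \<open>a x z\<close> and
  \<open>a x z ; f\<close> meet.\<close>

lemma stabilizer:
  assumes xz: "(x, z) \<in> atom_rel" and f: "f \<in> grp z" "f \<le> a z x \<^bold>; a x z"
  shows "a x z \<^bold>; f = a x z"
proof -
  note id = atom_relD(3,4)[OF xz]
  have "inf (rconv (a x z) \<^bold>; a x z) f = f"
    using f(2) a_rconv[OF xz] by (simp add: inf.absorb2)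
  moreover have "f \<noteq> bot"
    using grp_atom[OF id(2) measurable_atom_atom[OF atom_relD(2)[OF xz]] f(1)]
    by (simp add: ba_atom_def)
  ultimately have "inf (a x z) (a x z \<^bold>; f) \<noteq> bot"
    using peirce[of "a x z" "a x z" f] by simp
  moreover have "ba_atom (a x z \<^bold>; f)"
    using rcomp_grp_atom[OF id(2) f(1) a_atom[OF xz] a_le[OF xz]] .
  ultimately show ?thesis
    using ba_atom_le_if_meets a_atom[OF xz] by (metis antisym inf.commute)
qed

lemma stabilizer':
  assumes zy: "(z, y) \<in> atom_rel" and f: "f \<in> grp z" "f \<le> a z y \<^bold>; a y z"
  shows "f \<^bold>; a z y = a z y"
proof -
  have "rconv f \<le> rconv (a z y \<^bold>; a y z)" using f(2) by (rule rconv_mono)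
  then have "rconv f \<le> a z y \<^bold>; a y z"
    using a_rconv zy atom_rel_sym by (simp add: rconv_rcomp)
  then have "a y z \<^bold>; rconv f = a y z"
    using stabilizer atom_rel_sym[OF zy] grp_rconv[OF f(1)] by blast
  then show ?thesis
    by (metis a_rconv atom_rel_sym rconv_rcomp rconv_rconv zy)
qed

text \<open>The cycle law yields first \<open>f\<close> below \<open>u\<close> such that
  \<open>s\<close> meets \<open>f ; v\<close>, then \<open>g\<close> below both \<open>v\<close> and
  \<open>rconv f ; s\<close>. The latter is an atom, so \<open>g\<close> equals it.\<close>

lemma grp_factor:
  assumes z: "measurable_atom z" and s: "s \<in> grp z"
    and le: "s \<le> u \<^bold>; v" and u: "u \<le> z \<^bold>; top \<^bold>; z" and v: "v \<le> z \<^bold>; top \<^bold>; z"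
  obtains f g where "f \<in> grp z" "g \<in> grp z" "f \<le> u" "g \<le> v" "s = f \<^bold>; g"
proof -
  note id = measurable_atom_le_ident[OF z] and at = measurable_atom_atom[OF z]
  have nz: "t \<noteq> bot" if "t \<in> grp z" for t
    using grp_atom[OF id at that] by (simp add: ba_atom_def)
  have "inf s (u \<^bold>; v) \<noteq> bot" using nz[OF s] le by (simp add: inf.absorb1)
  then have "inf (s \<^bold>; rconv v) u \<noteq> bot" using peirce'[of s u v] by simp
  then obtain f where f: "f \<in> grp z" "f \<le> inf (s \<^bold>; rconv v) u"
    using measurable_obtain_grp[OF z _ order_trans[OF inf_le2 u]] by blast
  then have "inf (s \<^bold>; rconv v) f \<noteq> bot" using nz[OF f(1)] by (simp add: inf.absorb2)
  then have "inf s (f \<^bold>; v) \<noteq> bot" using peirce'[of s f v] by simp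
  then have "inf (rconv f \<^bold>; s) v \<noteq> bot" using peirce[of s f v] by simp
  then obtain g where g: "g \<in> grp z" "g \<le> inf (rconv f \<^bold>; s) v"
    using measurable_obtain_grp[OF z _ order_trans[OF inf_le2 v]] by blast
  have "ba_atom (rconv f \<^bold>; s)"
    using grp_atom[OF id at grp_rcomp[OF id grp_rconv[OF f(1)] s]] .
  then have "g = rconv f \<^bold>; s"
    using order_trans[OF g(2) inf_le1] nz[OF g(1)] unfolding ba_atom_def by blast
  then have "f \<^bold>; g = (f \<^bold>; rconv f) \<^bold>; s" by (simp only: rcomp_assoc)
  then have "s = f \<^bold>; g"
    by (simp only: grp_rcomp_rconv[OF f(1)] grp_left_unit[OF id s])
  then show thesis using that f g by auto
qed

lemma rcomp_top_le: "x \<^bold>; c \<^bold>; y \<le> x \<^bold>; top \<^bold>; y"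
  by (intro rcomp_mono order_refl top_greatest)

lemma a_rcomp_le: "(x, z) \<in> atom_rel \<Longrightarrow> a z x \<^bold>; a x z \<le> z \<^bold>; top \<^bold>; z"
  using rcomp_top_le[of z "a z x \<^bold>; a x z" z] a_left[OF atom_rel_sym, of x z] a_right[of x z]
  by (metis rcomp_assoc)

section \<open>The labelled base set\<close>

definition base :: "'a set" where
  "base = (\<Union>x\<in>Collect measurable_atom. grp x)"

text \<open>The group to which an element of the base belongs is indexed by its domain \<open>g;g\<^sup>\<smile>\<close>.\<close>

definition dom :: "'a \<Rightarrow> 'a" where
  "dom g = g \<^bold>; rconv g"

definition edges :: "('a \<times> 'a) set" where
  "edges = {(g, h). g \<in> base \<and> h \<in> base \<and> (dom g, dom h) \<in> atom_rel}"

definition label :: "'a \<Rightarrow> 'a \<Rightarrow> 'a" where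
  "label g h = rconv g \<^bold>; a (dom g) (dom h) \<^bold>; h"

definition rep :: "'a \<Rightarrow> ('a \<times> 'a) set" where
  "rep b = {(g, h) \<in> edges. label g h \<le> b}"

lemma dom_grp: "g \<in> grp x \<Longrightarrow> dom g = x"
  by (simp add: dom_def grp_rcomp_rconv)

lemma base_grp: "g \<in> base \<Longrightarrow> measurable_atom (dom g) \<and> g \<in> grp (dom g)"
  by (auto simp: base_def dom_grp)

lemma grp_base: "measurable_atom x \<Longrightarrow> g \<in> grp x \<Longrightarrow> g \<in> base"
  by (auto simp: base_def)

lemma edgeI: "(x, y) \<in> atom_rel \<Longrightarrow> g \<in> grp x \<Longrightarrow> h \<in> grp y \<Longrightarrow> (g, h) \<in> edges"
  using grp_base[OF atom_relD(1)] grp_base[OF atom_relD(2)] by (simp add: edges_def dom_grp)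

lemma edgeE:
  assumes "(g, h) \<in> edges"
  obtains x y where "(x, y) \<in> atom_rel" "g \<in> grp x" "h \<in> grp y" "label g h = rconv g \<^bold>; a x y \<^bold>; h"
  using assms base_grp by (auto simp: edges_def label_def)

lemma label_grp: "g \<in> grp x \<Longrightarrow> h \<in> grp y \<Longrightarrow> label g h = rconv g \<^bold>; a x y \<^bold>; h"
  by (simp add: label_def dom_grp)

lemma equiv_edges: "equiv base edges"
proof (rule equivI)
  show "refl_on base edges"
    using base_grp atom_rel_refl by (auto simp: refl_on_def edges_def)
  show "sym edges" using atom_rel_sym by (auto simp: sym_def edges_def)
  show "trans edges" using atom_rel_trans by (auto simp: trans_def edges_def)
  show "edges \<subseteq> base \<times> base" by (auto simp: edges_def)
qed

lemma edges_trans: "(g, k) \<in> edges \<Longrightarrow> (k, h) \<in> edges \<Longrightarrow> (g, h) \<in> edges"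
  using atom_rel_trans by (auto simp: edges_def)

lemma label_atom:
  assumes "(g, h) \<in> edges" shows "ba_atom (label g h)"
proof -
  obtain x y where xy: "(x, y) \<in> atom_rel" "g \<in> grp x" "h \<in> grp y"
      "label g h = rconv g \<^bold>; a x y \<^bold>; h"
    using assms by (rule edgeE)
  note id = atom_relD(3,4)[OF xy(1)]
  have "ba_atom (rconv g \<^bold>; a x y)"
    using grp_rcomp_atom[OF id(1) grp_rconv[OF xy(2)] a_atom[OF xy(1)], of "top \<^bold>; y"]
      a_le[OF xy(1)] by (simp add: rcomp_assoc)
  moreover have "rconv g \<^bold>; a x y \<le> rconv g \<^bold>; a x y \<^bold>; y"
    by (metis a_right[OF xy(1)] order_refl rcomp_assoc)
  ultimately show ?thesis
    using rcomp_grp_atom[OF id(2) xy(3)] xy(4) by simp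
qed

lemma label_rconv: "(g, h) \<in> edges \<Longrightarrow> label h g = rconv (label g h)"
  by (auto simp: edges_def label_def rconv_rcomp rconv_rconv rcomp_assoc a_rconv)

text \<open>The inner factor \<open>k ; rconv k\<close> is the unit of the group of \<open>k\<close>
  and is absorbed, which leaves the triangle condition of the scaffold.\<close>

lemma label_triangle:
  assumes "(g, k) \<in> edges" "(k, h) \<in> edges"
  shows "label g h \<le> label g k \<^bold>; label k h"
proof -
  obtain x z where xz: "(x, z) \<in> atom_rel" "g \<in> grp x" "k \<in> grp z"
    using assms(1) by (rule edgeE)
  obtain y where zy: "(z, y) \<in> atom_rel" "h \<in> grp y"
    using assms(2) xz(3) by (metis edgeE dom_grp)
  have "label g k \<^bold>; label k h = rconv g \<^bold>; (a x z \<^bold>; (k \<^bold>; rconv k) \<^bold>; a z y) \<^bold>; h"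
    using xz zy by (simp add: label_grp rcomp_assoc)
  also have "\<dots> = rconv g \<^bold>; (a x z \<^bold>; a z y) \<^bold>; h"
    using xz by (simp add: grp_rcomp_rconv a_right)
  finally show ?thesis
    using xz zy by (simp add: label_grp rcomp_mono a_trans)
qed

text \<open>Translation by \<open>g\<close> reduces this to \<open>obtain_a_rcomp_grp\<close>
  applied to \<open>g ; c\<close>.\<close>

lemma obtain_label:
  assumes xz: "(x, z) \<in> atom_rel" and g: "g \<in> grp x" and c: "c \<noteq> bot" "c \<le> x \<^bold>; top \<^bold>; z"
  obtains k where "k \<in> grp z" "label g k \<le> c"
proof -
  note id = atom_relD(3,4)[OF xz]
  have canc: "rconv g \<^bold>; (g \<^bold>; c) = c"
    using grp_cancel_left[OF id(1) g] c(2) by (metis rcomp_assoc)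
  have "g \<^bold>; c \<noteq> bot" using canc c(1) by auto
  moreover have "g \<^bold>; c \<le> x \<^bold>; top \<^bold>; z"
  proof -
    have "g \<^bold>; c \<le> x \<^bold>; g \<^bold>; (x \<^bold>; top \<^bold>; z)"
      using c(2) g id(1) by (simp add: grp_left_unit rcomp_mono)
    also have "\<dots> = x \<^bold>; (g \<^bold>; x \<^bold>; top) \<^bold>; z" by (simp add: rcomp_assoc)
    also have "\<dots> \<le> x \<^bold>; top \<^bold>; z" by (intro rcomp_mono order_refl top_greatest)
    finally show ?thesis .
  qed
  ultimately obtain k where k: "k \<in> grp z" "a x z \<^bold>; k \<le> g \<^bold>; c"
    by (rule obtain_a_rcomp_grp[OF xz])
  have "label g k = rconv g \<^bold>; (a x z \<^bold>; k)"
    using g k(1) by (simp add: label_grp rcomp_assoc)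
  also have "\<dots> \<le> rconv g \<^bold>; (g \<^bold>; c)" using k(2) by (simp add: rcomp_mono)
  finally have "label g k \<le> c" using canc by simp
  with k(1) show thesis by (rule that)
qed

lemma obtain_label':
  assumes zy: "(z, y) \<in> atom_rel" and h: "h \<in> grp y" and c: "c \<noteq> bot" "c \<le> z \<^bold>; top \<^bold>; y"
  obtains k where "k \<in> grp z" "label k h \<le> c"
proof -
  have "rconv c \<le> y \<^bold>; top \<^bold>; z"
    using rconv_mono[OF c(2)] atom_relD[OF zy]
    by (simp add: rconv_rcomp rconv_subident rcomp_assoc)
  then obtain k where k: "k \<in> grp z" "label h k \<le> rconv c"
    using obtain_label[OF atom_rel_sym[OF zy] h, of "rconv c"] c(1) by auto
  have "label k h = rconv (label h k)"
    using label_rconv edgeI atom_rel_sym[OF zy] h k(1) by blast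
  then show thesis using that k by (simp add: rconv_le_iff)
qed

text \<open>A label below the identity lies below both atoms \<open>x\<close> and \<open>y\<close>,
  so all three coincide. Then \<open>rconv g ; h\<close> is the group unit, which forces
  \<open>g = h\<close>.\<close>

lemma label_ident_iff:
  assumes "(g, h) \<in> edges" shows "label g h \<le> ident \<longleftrightarrow> g = h"
proof -
  obtain x y where xy: "(x, y) \<in> atom_rel" "g \<in> grp x" "h \<in> grp y"
      "label g h = rconv g \<^bold>; a x y \<^bold>; h"
    using assms by (rule edgeE)
  note id = atom_relD(3,4)[OF xy(1)]
  note at = atom_relD(1,2)[OF xy(1), THEN measurable_atom_atom]
  show ?thesis
  proof
    assume le: "label g h \<le> ident"
    have "label g h = x \<^bold>; label g h"
      using xy id by (simp add: rcomp_assoc grp_left_unit[OF _ grp_rconv])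
    then have lx: "label g h \<le> x"
      using subident_le_of_le_rcomp[OF id(1) le] by (metis order_refl)
    have "label g h = label g h \<^bold>; y"
      using xy id by (metis rcomp_assoc grp_right_unit)
    then have ly: "label g h \<le> y"
      using subident_le_of_le_rcomp'[OF id(2) le] by (metis order_refl)
    have "x = y" "label g h = x"
      using lx ly at label_atom[OF assms] by (auto simp: ba_atom_def)
    then have "rconv g \<^bold>; h = x"
      using xy id a_refl atom_relD(1)[OF xy(1)] by (simp add: grp_right_unit[OF _ grp_rconv])
    then have "g \<^bold>; rconv g \<^bold>; h = g"
      using xy(2) id by (metis rcomp_assoc grp_right_unit)
    then show "g = h"
      using xy \<open>x = y\<close> id by (simp add: grp_rcomp_rconv grp_left_unit)
  next
    assume "g = h"
    then have "x = y" using xy dom_grp by blast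
    then have "label g h = x"
      using xy \<open>g = h\<close> id a_refl atom_relD(1)[OF xy(1)]
      by (simp add: grp_right_unit[OF _ grp_rconv] grp_rconv_rcomp)
    then show "label g h \<le> ident" using id by simp
  qed
qed

section \<open>Witnesses for nonempty images and for composition\<close>

lemma meets_measurable:
  assumes "c \<noteq> bot"
  obtains x where "measurable_atom x" "x \<^bold>; c \<noteq> bot"
proof -
  obtain X where X: "\<forall>x\<in>X. measurable_atom x" "isLub UNIV X ident"
    using measurable by blast
  have "inf c (ident \<^bold>; c) \<noteq> bot" using assms by (simp add: ident_rcomp)
  \<comment> \<open>The cycle law is used to pass to the identity, which is a sum of measurable
    atoms, and again to come back from one of these atoms.\<close>
  then have "inf (c \<^bold>; rconv c) ident \<noteq> bot" using peirce' by blast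
  then obtain x where x: "x \<in> X" "inf (c \<^bold>; rconv c) x \<noteq> bot"
    using isLub_meets[OF X(2)] by blast
  then have "inf c (x \<^bold>; c) \<noteq> bot" using peirce' by blast
  then have "x \<^bold>; c \<noteq> bot" by auto
  then show thesis using that X(1) x(1) by blast
qed

lemma meets_measurable':
  assumes "c \<noteq> bot"
  obtains y where "measurable_atom y" "c \<^bold>; y \<noteq> bot"
proof -
  obtain y where "measurable_atom y" "y \<^bold>; rconv c \<noteq> bot"
    using meets_measurable[of "rconv c"] assms by auto
  then show thesis
    using that by (metis measurable_atom_le_ident rconv_eq_bot_iff rconv_rcomp rconv_rconv rconv_subident)
qed

lemma atom_relI:
  assumes "measurable_atom x" "measurable_atom y" "x \<^bold>; c \<^bold>; y \<noteq> bot"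
  shows "(x, y) \<in> atom_rel"
  using assms rcomp_top_le[of x c y] by (auto simp: atom_rel_def bot_unique)

text \<open>Cut \<open>c\<close> down to a nonzero \<open>x ; c ; y\<close> and start the edge at
  the unit \<open>x\<close> of its group. Injectivity of \<open>rep\<close> rests on this.\<close>

lemma rep_nonempty:
  assumes "c \<noteq> bot" shows "rep c \<noteq> {}"
proof -
  obtain x where x: "measurable_atom x" "x \<^bold>; c \<noteq> bot"
    using assms by (rule meets_measurable)
  obtain y where y: "measurable_atom y" "x \<^bold>; c \<^bold>; y \<noteq> bot"
    using x(2) by (rule meets_measurable')
  note id = measurable_atom_le_ident[OF x(1)] measurable_atom_le_ident[OF y(1)]
  have xy: "(x, y) \<in> atom_rel" using x(1) y by (rule atom_relI)
  obtain k where k: "k \<in> grp y" "label x k \<le> x \<^bold>; c \<^bold>; y"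
    using obtain_label[OF xy grp_unit[OF id(1)] y(2) rcomp_top_le] by blast
  have "x \<^bold>; c \<^bold>; y \<le> c"
    using id by (meson order_trans rcomp_subident_le subident_rcomp_le)
  then have "label x k \<le> c" using k(2) by (rule order_trans[rotated])
  then show ?thesis
    using edgeI[OF xy grp_unit[OF id(1)] k(1)] by (auto simp: rep_def)
qed

lemma label_factor:
  assumes e: "(g, h) \<in> edges" and le: "label g h \<le> b \<^bold>; c"
  shows "\<exists>k. (g, k) \<in> edges \<and> (k, h) \<in> edges \<and> label g k \<le> b \<and> label k h \<le> c"
proof -
  obtain x y where xy: "(x, y) \<in> atom_rel" and g: "g \<in> grp x" and h: "h \<in> grp y"
      and lab: "label g h = rconv g \<^bold>; a x y \<^bold>; h"
    using e by (rule edgeE)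
  let ?p = "label g h"
  note idx = atom_relD(3)[OF xy] and idy = atom_relD(4)[OF xy]
  have px: "x \<^bold>; ?p = ?p"
    using lab g idx by (simp add: rcomp_assoc grp_left_unit[OF _ grp_rconv])
  have py: "?p \<^bold>; y = ?p"
    using lab h idy by (metis rcomp_assoc grp_right_unit)
  have pn: "?p \<noteq> bot" using label_atom[OF e] by (simp add: ba_atom_def)
  \<comment> \<open>The part of \<open>b\<close> available for a left factor: by the cycle law, any
    nonzero \<open>r\<close> below it has \<open>r ; c\<close> meeting \<open>?p\<close>.\<close>
  let ?q = "inf b (?p \<^bold>; rconv c)"
  have "inf (?p \<^bold>; rconv c) b \<noteq> bot"
    using pn le peirce'[of ?p b c] by (simp add: inf.absorb1)
  then have "?q \<noteq> bot" by (simp add: inf.commute)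
  then obtain z where z: "measurable_atom z" "?q \<^bold>; z \<noteq> bot"
    by (rule meets_measurable')
  note idz = measurable_atom_le_ident[OF z(1)]
  have "?q \<le> x \<^bold>; (?p \<^bold>; rconv c)" using px by (simp add: rcomp_assoc)
  then have qx: "x \<^bold>; ?q = ?q" by (rule subident_rcomp_absorb[OF idx])
  have xz: "(x, z) \<in> atom_rel"
    using atom_relI[OF atom_relD(1)[OF xy] z(1), of ?q] qx z(2) by simp
  have "?q \<^bold>; z \<le> x \<^bold>; top \<^bold>; z" using qx rcomp_top_le[of x ?q z] by simp
  then obtain k where k: "k \<in> grp z" "label g k \<le> ?q \<^bold>; z"
    using obtain_label[OF xz g z(2)] by blast
  have gk: "(g, k) \<in> edges" using edgeI[OF xz g k(1)] .
  let ?l = "label g k"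
  have lq: "?l \<le> ?q" using k(2) rcomp_subident_le[OF idz, of ?q] by (rule order_trans)
  have lz: "?l \<^bold>; z = ?l" using idz k(2) by (rule rcomp_subident_absorb)
  have "inf (?p \<^bold>; rconv c) ?l \<noteq> bot"
    using lq label_atom[OF gk] by (simp add: inf.absorb2 ba_atom_def)
  then have "inf ?p (?l \<^bold>; c) \<noteq> bot" using peirce' by blast
  then have rn: "inf (rconv ?l \<^bold>; ?p) c \<noteq> bot" using peirce by blast
  have zy: "(z, y) \<in> atom_rel" using atom_rel_trans[OF atom_rel_sym[OF xz] xy] .
  have "rconv ?l = z \<^bold>; rconv ?l" using lz idz by (metis rconv_rcomp rconv_subident)
  then have "rconv ?l \<^bold>; ?p = z \<^bold>; (rconv ?l \<^bold>; ?p) \<^bold>; y" using py by (metis rcomp_assoc)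
  then have "rconv ?l \<^bold>; ?p \<le> z \<^bold>; top \<^bold>; y" by (metis rcomp_top_le)
  then have "inf (rconv ?l \<^bold>; ?p) c \<le> z \<^bold>; top \<^bold>; y" by (simp add: le_infI1)
  \<comment> \<open>The second label is chosen compatibly with the first, but its vertex
    \<open>m\<close> may differ from \<open>k\<close>; \<open>?s\<close> below measures the
    discrepancy.\<close>
  then obtain m where m: "m \<in> grp z" "label m h \<le> inf (rconv ?l \<^bold>; ?p) c"
    using obtain_label'[OF zy h rn] by blast
  have mh: "(m, h) \<in> edges" using edgeI[OF zy m(1) h] .
  let ?r = "label m h" and ?s = "k \<^bold>; rconv m"
  have s: "?s \<in> grp z" using grp_rcomp[OF idz k(1) grp_rconv[OF m(1)]] .
  have "inf ?p (?l \<^bold>; ?r) \<noteq> bot"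
    using m(2) label_atom[OF mh] peirce[of ?p ?l ?r] by (simp add: inf.absorb2 ba_atom_def)
  then have "?p \<le> ?l \<^bold>; ?r" by (rule ba_atom_le_if_meets[OF label_atom[OF e]])
  \<comment> \<open>Multiplying by \<open>g\<close> and \<open>rconv h\<close> strips the outer
    group elements off the labels.\<close>
  then have "g \<^bold>; ?p \<^bold>; rconv h \<le> g \<^bold>; (?l \<^bold>; ?r) \<^bold>; rconv h"
    by (simp add: rcomp_mono)
  moreover have "g \<^bold>; ?p \<^bold>; rconv h = (g \<^bold>; rconv g) \<^bold>; a x y \<^bold>; (h \<^bold>; rconv h)"
    using lab by (simp add: rcomp_assoc)
  then have "g \<^bold>; ?p \<^bold>; rconv h = a x y"
    using g h xy by (simp add: grp_rcomp_rconv a_left a_right)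
  moreover have "g \<^bold>; (?l \<^bold>; ?r) \<^bold>; rconv h
      = ((g \<^bold>; rconv g) \<^bold>; a x z) \<^bold>; ?s \<^bold>; (a z y \<^bold>; (h \<^bold>; rconv h))"
    using g h k(1) m(1) by (simp add: label_grp rcomp_assoc)
  then have "g \<^bold>; (?l \<^bold>; ?r) \<^bold>; rconv h = a x z \<^bold>; ?s \<^bold>; a z y"
    using g h xz zy by (simp add: grp_rcomp_rconv a_left a_right)
  ultimately have "a x y \<le> a x z \<^bold>; ?s \<^bold>; a z y" by simp
  \<comment> \<open>Two cycle laws now isolate the atom \<open>?s\<close>.\<close>
  then have "inf (a x y) (a x z \<^bold>; ?s \<^bold>; a z y) \<noteq> bot"
    using a_atom[OF xy] by (simp add: inf.absorb1 ba_atom_def)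
  then have "inf (a x y \<^bold>; a y z) (a x z \<^bold>; ?s) \<noteq> bot"
    using peirce'[of "a x y" "a x z \<^bold>; ?s" "a z y"] a_rconv[OF zy] by simp
  then have "inf (a z x \<^bold>; (a x y \<^bold>; a y z)) ?s \<noteq> bot"
    using peirce[of "a x y \<^bold>; a y z" "a x z" ?s] a_rconv[OF xz] by simp
  then have "?s \<le> a z x \<^bold>; (a x y \<^bold>; a y z)"
    using ba_atom_le_if_meets[OF grp_atom[OF idz measurable_atom_atom[OF z(1)] s]]
    by (simp add: inf.commute)
  also have "\<dots> \<le> a z x \<^bold>; ((a x z \<^bold>; a z y) \<^bold>; a y z)"
    by (intro rcomp_mono order_refl a_trans xz zy)
  also have "\<dots> = (a z x \<^bold>; a x z) \<^bold>; (a z y \<^bold>; a y z)" by (simp add: rcomp_assoc)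
  finally obtain u v where u: "u \<in> grp z" "u \<le> a z x \<^bold>; a x z"
      and v: "v \<in> grp z" "v \<le> a z y \<^bold>; a y z" and suv: "?s = u \<^bold>; v"
    using grp_factor[OF z(1) s _ a_rcomp_le[OF xz] a_rcomp_le[OF atom_rel_sym[OF zy]]] by metis
  \<comment> \<open>The common witness. From \<open>k = u ; ?n\<close> and \<open>u\<close>
    stabilizing \<open>a x z\<close>, the label from \<open>g\<close> is that of \<open>k\<close>;
    since \<open>v\<close> stabilizes \<open>a z y\<close>, the label to \<open>h\<close> is that of
    \<open>m\<close>.\<close>
  let ?n = "v \<^bold>; m"
  have n: "?n \<in> grp z" using grp_rcomp[OF idz v(1) m(1)] .
  have ksm: "k = ?s \<^bold>; m"
    by (metis grp_rconv_rcomp[OF m(1)] grp_right_unit[OF idz k(1)] rcomp_assoc)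
  have "a x z \<^bold>; k = a x z \<^bold>; u \<^bold>; ?n"
    by (metis ksm suv rcomp_assoc)
  then have "a x z \<^bold>; k = a x z \<^bold>; ?n" using stabilizer[OF xz u] by simp
  then have "label g ?n = ?l"
    using label_grp[OF g k(1)] label_grp[OF g n] by (metis rcomp_assoc)
  then have gn: "label g ?n \<le> b" using lq by simp
  have "rconv v \<^bold>; a z y = rconv v \<^bold>; v \<^bold>; a z y"
    by (metis stabilizer'[OF zy v] rcomp_assoc)
  then have "rconv v \<^bold>; a z y = a z y"
    using v(1) by (simp add: grp_rconv_rcomp a_left[OF zy])
  then have "label ?n h = label m h"
    using label_grp[OF m(1) h] label_grp[OF n h] by (metis rconv_rcomp rcomp_assoc)
  then have "label ?n h \<le> c" using m(2) by simp
  with gn edgeI[OF xz g n] edgeI[OF zy n h] show ?thesis by (intro exI conjI)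
qed

section \<open>The clauses of a complete representation\<close>

lemma rep_rcomp: "rep (b \<^bold>; c) = rep b O rep c"
proof
  show "rep (b \<^bold>; c) \<subseteq> rep b O rep c"
    using label_factor unfolding rep_def by blast
  show "rep b O rep c \<subseteq> rep (b \<^bold>; c)"
  proof
    fix t assume "t \<in> rep b O rep c"
    then obtain g k h where t: "t = (g, h)" and gk: "(g, k) \<in> edges" "label g k \<le> b"
        and kh: "(k, h) \<in> edges" "label k h \<le> c"
      by (auto simp: rep_def)
    have "label g h \<le> label g k \<^bold>; label k h" using label_triangle[OF gk(1) kh(1)] .
    also have "\<dots> \<le> b \<^bold>; c" using gk(2) kh(2) by (rule rcomp_mono)
    finally show "t \<in> rep (b \<^bold>; c)" using t edges_trans[OF gk(1) kh(1)] by (simp add: rep_def)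
  qed
qed

lemma edges_sym: "(g, h) \<in> edges \<Longrightarrow> (h, g) \<in> edges"
  using atom_rel_sym by (simp add: edges_def)

lemma rep_rconv: "rep (rconv b) = (rep b)\<inverse>"
proof -
  have "label g h \<le> rconv b \<longleftrightarrow> label h g \<le> b" if "(g, h) \<in> edges" for g h
    by (simp only: label_rconv[OF that] rconv_le_iff)
  then show ?thesis
    using edges_sym by (auto simp: rep_def)
qed

lemma rep_compl: "rep (- b) = edges - rep b"
  by (auto simp: rep_def ba_atom_le_compl_iff[OF label_atom])

lemma rep_isLub: "isLub UNIV X s \<Longrightarrow> rep s = (\<Union>b\<in>X. rep b)"
  by (auto simp: rep_def ba_atom_le_isLub_iff[OF label_atom])

lemma rep_ident: "rep ident = Id_on base"
  using label_ident_iff equiv_edges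
  by (auto simp: rep_def edges_def equiv_def refl_on_def)

text \<open>If \<open>b\<close> is not below \<open>c\<close>, the difference
  \<open>inf b (- c)\<close> has a nonempty image, which lies in \<open>rep b\<close> but outside
  \<open>rep c\<close>.\<close>

lemma rep_mono_iff: "rep b \<subseteq> rep c \<longleftrightarrow> b \<le> c"
proof
  assume sub: "rep b \<subseteq> rep c"
  have "rep (inf b (- c)) \<subseteq> rep b \<inter> rep (- c)" by (auto simp: rep_def)
  also have "\<dots> = {}" using sub by (auto simp: rep_compl)
  finally have "inf b (- c) = bot" using rep_nonempty by blast
  then show "b \<le> c" by (simp add: inf_shunt)
qed (auto simp: rep_def)

lemma complete_representation_rep: "complete_representation rcomp rconv ident base edges rep"
  unfolding complete_representation_def
proof (intro conjI allI impI)
  show "inj rep" by (rule injI) (simp add: antisym flip: rep_mono_iff)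
  show "rep (sup b c) = rep b \<union> rep c" for b c
    using rep_isLub[OF isLub_sup] by auto
qed (use equiv_edges rep_compl rep_rcomp rep_rconv rep_ident rep_isLub in \<open>auto simp: rep_def\<close>)

end

text \<open>The constructed base consists of elements of the algebra; transport along
  \<open>Inl\<close> puts it into the sum type that \<open>completely_representable\<close> asks
  for.\<close>

lemma complete_representation_image:
  fixes i :: "'u \<Rightarrow> 'v"
  assumes "complete_representation rcomp rconv ident U E \<theta>" and i: "inj i"
  shows "complete_representation rcomp rconv ident (i ` U) (map_prod i i ` E)
    (\<lambda>b. map_prod i i ` \<theta> b)"
proof -
  let ?m = "(`) (map_prod i i)"
  have injm: "inj (map_prod i i)" using i by (simp add: prod.inj_map)
  \<comment> \<open>Injectivity of \<open>i\<close> makes the two preimages of a middle point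
    agree.\<close>
  have comp: "?m (R O S) = ?m R O ?m S" for R S
    using i by (fastforce simp: relcomp_unfold inj_def image_iff)
  have conv: "?m (R\<inverse>) = (?m R)\<inverse>" for R by force
  have "equiv (i ` U) (?m E)" if eq: "equiv U E"
  proof (rule equivI)
    show "refl_on (i ` U) (?m E)" using eq by (force simp: equiv_def refl_on_def)
    show "sym (?m E)" using eq by (force simp: equiv_def sym_def)
    have "?m E O ?m E = ?m (E O E)" by (simp add: comp)
    also have "\<dots> \<subseteq> ?m E" using eq by (intro image_mono) (auto simp: equiv_def trans_O_subset)
    finally have "?m E O ?m E \<subseteq> ?m E" .
    then show "trans (?m E)" by (meson relcompI subsetD transI)
    show "?m E \<subseteq> i ` U \<times> i ` U" using eq by (auto simp: equiv_def)
  qed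
  moreover have "inj (\<lambda>b. ?m (\<theta> b))" if "inj \<theta>"
    using that injm by (simp add: inj_def inj_image_eq_iff)
  moreover have "?m (Id_on U) = Id_on (i ` U)" by force
  ultimately show ?thesis
    using assms(1) unfolding complete_representation_def
    by (simp add: image_mono image_Un image_set_diff[OF injm] image_UN flip: comp conv)
qed

theorem corollary7p5:
  fixes rcomp :: "'a::boolean_algebra \<Rightarrow> 'a \<Rightarrow> 'a"
    and rconv :: "'a \<Rightarrow> 'a"
    and ident :: 'a
  assumes "measurable_relation_algebra rcomp rconv ident"
    and "\<exists>a. relation_algebra.scaffold rcomp rconv ident a"
  shows "completely_representable rcomp rconv ident"
proof -
  obtain a where "relation_algebra.scaffold rcomp rconv ident a"
    using assms(2) by blast
  then interpret scaffolded_relation_algebra rcomp rconv ident a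
    using assms(1)
    by (simp add: scaffolded_relation_algebra_def scaffolded_relation_algebra_axioms_def)
  show ?thesis
    unfolding completely_representable_def
    using complete_representation_image[OF complete_representation_rep inj_Inl] by blast
qed

end
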